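(* Let $N\ge1$ be an integer, $c>0$, and let $a<0<b$ be integers. For $z\in(0,1/M_1)$ there exist polynomials $P_k(z,\zeta)$, $1\le k\le2N$, in the variable $\zeta$, of degree $(b-a-1)$, such that, setting $$\mathbf{\tilde L}_k(z,\zeta)=P_k(z,\zeta)\prod_{\substack{1\le j\le2N\\ j\ne k}}\frac{\zeta-u_j(z)}{u_k(z)-u_j(z)},\qquad k\in\{1,\dots,2N\},$$ the $\mathbf{\tilde L}_k$ are interpolation polynomials in $\zeta$ satisfying $\mathbf{\tilde L}_k(z,u_j(z))=\delta_{jk}$ for $j,k\in\{1,\dots,2N\}$, and the double generating function of $(\sigma_{ab},S_{ab})$ is given, for any $\zeta\in\mathbb{C}\setminus\{0\}$, by $$\mathbb{E}\!\left(z^{\sigma_{ab}}\zeta^{S_{ab}}1_{\{\sigma_{ab}<+\infty\}}\right)=\sum_{k=1}^{2N}\mathbf{\tilde L}_k(z,\zeta)\,\big(v_k(z)\zeta\big)^{a-N+1}.$$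
   Context: Pseudo-random walk: put $p_k=\delta_{k0}+(-1)^{k-1}c\binom{2N}{k+N}$ for $k\in\{-N,\dots,N\}$ (real numbers, possibly negative, summing to $1$) and $p_k=0$ for other integers $k$. The $U_n$, $n\ge1$, are i.i.d. pseudo-random variables with $\mathbb{P}\{U_n=k\}=p_k$, i.e. $\mathbb{P}\{U_1=k_1,\dots,U_n=k_n\}=p_{k_1}\cdots p_{k_n}$ (a signed measure of total mass one); $S_0=0$, $S_n=U_1+\dots+U_n$. First exit time: $\sigma_{ab}=\min\{n\ge1:S_n\le a\text{ or }S_n\ge b\}$ ($\min\emptyset=+\infty$), $S_{ab}=S_{\sigma_{ab}}\in\mathcal{E}=\{a-N+1,\dots,a\}\cup\{b,\dots,b+N-1\}$; $\mathbb{P}\{\sigma_{ab}=k,S_{ab}=\ell\}=\mathbb{P}\{S_1\in(a,b),\dots,S_{k-1}\in(a,b),S_k=\ell\}$ for $k\ge1$. $M_1=\sum_{k=-N}^N|p_k|\ge1$. For $|z|<1/M_1$, $$\mathbb{E}\big(z^{\sigma_{ab}}\zeta^{S_{ab}}1_{\{\sigma_{ab}<+\infty\}}\big)=\sum_{\ell\in\mathcal{E}}\Big(\sum_{k\ge1}\mathbb{P}\{\sigma_{ab}=k,S_{ab}=\ell\}z^k\Big)\zeta^\ell,$$ the inner series being absolutely convergent. Roots: for $z\in(0,1)$ and $1\le j\le N$, let $\theta_j=-\mathrm{e}^{\mathrm{i}\frac{2j-1}{N}\pi}$ and $w(z)=\frac12\sqrt[N]{(1-z)/(cz)}$. The quadratic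 equation $u^2-2[1+\theta_jw(z)]u+1=0$ has exactly one root of modulus $<1$, denoted $u_j(z)$; one sets $u_{j+N}(z)=1/u_j(z)$ for $1\le j\le N$, and $v_j(z)=1/u_j(z)$ for $1\le j\le2N$. The numbers $u_1(z),\dots,u_{2N}(z)$ are pairwise distinct. *)

theory Defs
  imports
    "HOL-Analysis.Analysis"
    "HOL-Computational_Algebra.Polynomial"
    "HOL-Library.Extended_Nat"
begin

section \<open>The pseudo-random walk\<close>

definition step_prob :: "nat \<Rightarrow> real \<Rightarrow> int \<Rightarrow> real" where
  "step_prob N c k =
     (if k \<in> {- int N..int N}
      then (if k = 0 then 1 else 0) + (-1) powi (k - 1) * c * real ((2 * N) choose nat (k + int N))
      else 0)"

definition M1 :: "nat \<Rightarrow> real \<Rightarrow> real" where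
  "M1 N c = (\<Sum>k\<in>{- int N..int N}. \<bar>step_prob N c k\<bar>)"

text \<open>
  A trajectory of the walk is given by its increments \<open>x 1, x 2, \<dots>\<close>. The signed measure
  \<open>walk_prob N c n\<close> is the joint law of \<open>U\<^sub>1, \<dots>, U\<^sub>n\<close>; it is carried by the finitely many
  trajectories of length \<open>n\<close> with increments in \<open>{-N..N}\<close>. The values of such a trajectory outside
  \<open>{1..n}\<close> are \<open>undefined\<close>, so \<open>walk_prob N c n A\<close> is meaningful only when \<open>A\<close> is determined by
  the first \<open>n\<close> increments.
\<close>

definition walk_prob :: "nat \<Rightarrow> real \<Rightarrow> nat \<Rightarrow> ((nat \<Rightarrow> int) \<Rightarrow> bool) \<Rightarrow> real" where
  "walk_prob N c n A =
     (\<Sum>x | x \<in> {1..n} \<rightarrow>\<^sub>E {- int N..int N} \<and> A x. \<Prod>i=1..n. step_prob N c (x i))"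

definition walk :: "(nat \<Rightarrow> int) \<Rightarrow> nat \<Rightarrow> int" where
  "walk x n = (\<Sum>i=1..n. x i)"

definition exit_time :: "int \<Rightarrow> int \<Rightarrow> (nat \<Rightarrow> int) \<Rightarrow> enat" where
  "exit_time a b x = Inf {enat n |n. 1 \<le> n \<and> (walk x n \<le> a \<or> b \<le> walk x n)}"

text \<open>Meaningful only for trajectories with finite exit time.\<close>

definition exit_position :: "int \<Rightarrow> int \<Rightarrow> (nat \<Rightarrow> int) \<Rightarrow> int" where
  "exit_position a b x = walk x (the_enat (exit_time a b x))"

definition exit_set :: "nat \<Rightarrow> int \<Rightarrow> int \<Rightarrow> int set" where
  "exit_set N a b = {a - int N + 1..a} \<union> {b..b + int N - 1}"

text \<open>
  The event that the exit time equals \<open>k\<close> is determined by the first \<open>k\<close> increments, so the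
  law of \<open>U\<^sub>1, \<dots>, U\<^sub>k\<close> suffices.
\<close>

definition exit_prob :: "nat \<Rightarrow> real \<Rightarrow> int \<Rightarrow> int \<Rightarrow> nat \<Rightarrow> int \<Rightarrow> real" where
  "exit_prob N c a b k l =
     walk_prob N c k (\<lambda>x. exit_time a b x = enat k \<and> exit_position a b x = l)"

definition exit_genfun ::
  "nat \<Rightarrow> real \<Rightarrow> int \<Rightarrow> int \<Rightarrow> complex \<Rightarrow> complex \<Rightarrow> complex" where
  "exit_genfun N c a b z \<zeta> =
     (\<Sum>l\<in>exit_set N a b.
        (\<Sum>k. of_real (exit_prob N c a b (Suc k) l) * z ^ Suc k) * \<zeta> powi l)"

lemma exit_time_eq_enat_iff:
  assumes "1 \<le> k"
  shows "exit_time a b x = enat k \<longleftrightarrow>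
    (\<forall>i\<in>{1..<k}. walk x i \<in> {a<..<b}) \<and> (walk x k \<le> a \<or> b \<le> walk x k)"
proof -
  define T where "T = {enat n |n. 1 \<le> n \<and> (walk x n \<le> a \<or> b \<le> walk x n)}"
  have T: "enat n \<in> T \<longleftrightarrow> 1 \<le> n \<and> (walk x n \<le> a \<or> b \<le> walk x n)" for n
    by (auto simp: T_def)
  have "Inf T = enat k \<longleftrightarrow> enat k \<in> T \<and> (\<forall>y\<in>T. enat k \<le> y)"
  proof
    assume I: "Inf T = enat k"
    then have "T \<noteq> {}"
      by (metis Inf_empty enat.distinct(1) top_enat_def)
    then have "Inf T \<in> T"
      by (simp add: wellorder_InfI Inf_enat_def) (metis LeastI_ex ex_in_conv)
    then show "enat k \<in> T \<and> (\<forall>y\<in>T. enat k \<le> y)"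
      using I by (metis Inf_lower)
  next
    assume "enat k \<in> T \<and> (\<forall>y\<in>T. enat k \<le> y)"
    then show "Inf T = enat k"
      by (meson Inf_greatest Inf_lower antisym)
  qed
  also have "\<dots> \<longleftrightarrow> enat k \<in> T \<and> (\<forall>i. enat i \<in> T \<longrightarrow> k \<le> i)"
    by (auto simp: T_def)
  also have "\<dots> \<longleftrightarrow>
    (\<forall>i\<in>{1..<k}. walk x i \<in> {a<..<b}) \<and> (walk x k \<le> a \<or> b \<le> walk x k)"
  proof (intro iffI conjI)
    assume L: "enat k \<in> T \<and> (\<forall>i. enat i \<in> T \<longrightarrow> k \<le> i)"
    then show "walk x k \<le> a \<or> b \<le> walk x k"
      by (simp add: T)
    show "\<forall>i\<in>{1..<k}. walk x i \<in> {a<..<b}"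
    proof
      fix i assume i: "i \<in> {1..<k}"
      then have "enat i \<notin> T"
        using L by (auto simp: not_le[symmetric])
      then show "walk x i \<in> {a<..<b}"
        using i by (auto simp: T)
    qed
  next
    assume R: "(\<forall>i\<in>{1..<k}. walk x i \<in> {a<..<b}) \<and> (walk x k \<le> a \<or> b \<le> walk x k)"
    then show "enat k \<in> T"
      using assms by (simp add: T)
    show "\<forall>i. enat i \<in> T \<longrightarrow> k \<le> i"
    proof (intro allI impI)
      fix i assume "enat i \<in> T"
      then have i: "1 \<le> i" "walk x i \<notin> {a<..<b}"
        by (auto simp: T)
      show "k \<le> i"
      proof (rule ccontr)
        assume "\<not> k \<le> i"
        with i(1) have "i \<in> {1..<k}"
          by simp
        with R i(2) show False
          by blast
      qed
    qed
  qed
  finally show ?thesis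
    by (simp add: exit_time_def T_def)
qed

lemma exit_prob_eq:
  assumes "1 \<le> k" and "l \<le> a \<or> b \<le> l"
  shows "exit_prob N c a b k l =
    walk_prob N c k (\<lambda>x. (\<forall>i\<in>{1..<k}. walk x i \<in> {a<..<b}) \<and> walk x k = l)"
proof -
  have "(exit_time a b x = enat k \<and> exit_position a b x = l) \<longleftrightarrow>
    (\<forall>i\<in>{1..<k}. walk x i \<in> {a<..<b}) \<and> walk x k = l" for x
    using assms exit_time_eq_enat_iff[of k a b x] by (auto simp: exit_position_def)
  then show ?thesis
    by (simp add: exit_prob_def)
qed

lemma abs_walk_prob_le: "\<bar>walk_prob N c n A\<bar> \<le> M1 N c ^ n"
proof -
  let ?X = "{1..n} \<rightarrow>\<^sub>E {- int N..int N}"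
  have fin: "finite ?X"
    by (intro finite_PiE) auto
  have "\<bar>walk_prob N c n A\<bar> \<le> (\<Sum>x | x \<in> ?X \<and> A x. \<Prod>i=1..n. \<bar>step_prob N c (x i)\<bar>)"
    unfolding walk_prob_def using sum_abs by (simp flip: abs_prod)
  also have "\<dots> \<le> (\<Sum>x\<in>?X. \<Prod>i=1..n. \<bar>step_prob N c (x i)\<bar>)"
    by (intro sum_mono2 fin) (auto intro: prod_nonneg)
  also have "\<dots> = (\<Prod>i=1..n. \<Sum>k\<in>{- int N..int N}. \<bar>step_prob N c k\<bar>)"
    by (subst prod_sum_PiE) auto
  finally show ?thesis
    by (simp add: M1_def)
qed

lemma exit_genfun_summable:
  fixes z :: complex
  assumes "norm z < 1 / M1 N c"
  shows "summable (\<lambda>k. norm (of_real (exit_prob N c a b (Suc k) l) * z ^ Suc k))"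
proof (rule summable_comparison_test)
  have pos: "M1 N c > 0"
    using assms by (metis less_le_trans linorder_not_less norm_ge_zero zero_less_divide_1_iff)
  have "norm (norm (of_real (exit_prob N c a b (Suc k) l) * z ^ Suc k))
      \<le> (M1 N c * norm z) ^ Suc k" for k
    unfolding norm_mult norm_power power_mult_distrib norm_of_real exit_prob_def
      real_norm_def abs_mult abs_abs abs_norm_cancel power_abs
    by (rule mult_right_mono[OF abs_walk_prob_le]) auto
  then show "\<exists>M. \<forall>k\<ge>M. norm (norm (of_real (exit_prob N c a b (Suc k) l) * z ^ Suc k))
      \<le> (M1 N c * norm z) ^ Suc k"
    by blast
  have "norm (M1 N c * norm z) < 1"
    using assms pos by (simp add: abs_mult field_simps)
  then show "summable (\<lambda>k. (M1 N c * norm z) ^ Suc k)"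
    by (subst summable_Suc_iff) (rule summable_geometric)
qed


section \<open>The roots\<close>

definition theta :: "nat \<Rightarrow> nat \<Rightarrow> complex" where
  "theta N j = - cis ((2 * real j - 1) / real N * pi)"

definition w_fun :: "nat \<Rightarrow> real \<Rightarrow> real \<Rightarrow> real" where
  "w_fun N c z = 1 / 2 * root N ((1 - z) / (c * z))"

definition is_small_root :: "nat \<Rightarrow> real \<Rightarrow> real \<Rightarrow> nat \<Rightarrow> complex \<Rightarrow> bool" where
  "is_small_root N c z j u \<longleftrightarrow>
     u\<^sup>2 - 2 * (1 + theta N j * of_real (w_fun N c z)) * u + 1 = 0 \<and> norm u < 1"

definition u_root :: "nat \<Rightarrow> real \<Rightarrow> real \<Rightarrow> nat \<Rightarrow> complex" where
  "u_root N c z j =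
     (if j \<le> N then THE u. is_small_root N c z j u
      else 1 / (THE u. is_small_root N c z (j - N) u))"

definition v_root :: "nat \<Rightarrow> real \<Rightarrow> real \<Rightarrow> nat \<Rightarrow> complex" where
  "v_root N c z j = 1 / u_root N c z j"

lemma theta_neq_minus_one:
  assumes "1 \<le> j" "j \<le> N"
  shows "theta N j \<noteq> - 1"
proof
  assume "theta N j = - 1"
  then have "cos ((2 * real j - 1) / real N * pi) = 1"
    by (simp add: theta_def complex_eq_iff)
  then obtain n :: int where n: "(2 * real j - 1) / real N * pi = of_int n * 2 * pi"
    by (auto simp: cos_one_2pi_int)
  then have "2 * real j - 1 = 2 * of_int n * real N"
  proof -
    have "pi * (2 * real j - 1) = pi * (2 * of_int n * real N)"
      using n assms by (simp add: field_simps)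
    then show ?thesis
      by simp
  qed
  then have "of_int (2 * int j - 1) = (of_int (2 * n * int N) :: real)"
    by simp
  then have "2 * int j - 1 = 2 * n * int N"
    by (simp only: of_int_eq_iff)
  then have "2 * int j - 1 = 2 * (n * int N)"
    by simp
  then show False
    by presburger
qed

lemma ex1_small_root:
  assumes "1 \<le> j" "j \<le> N" "0 < c" "0 < z" "z < 1"
  shows "\<exists>!u. is_small_root N c z j u"
proof -
  define B where "B = 1 + theta N j * of_real (w_fun N c z)"
  have w: "w_fun N c z > 0"
    using assms by (simp add: w_fun_def)
  define s where "s = csqrt (B\<^sup>2 - 1)"
  have s: "s\<^sup>2 = B\<^sup>2 - 1"
    by (simp add: s_def)
  have fac: "u\<^sup>2 - 2 * B * u + 1 = (u - (B + s)) * (u - (B - s))" for u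
    using s by (simp add: algebra_simps power2_eq_square)
  have prod1: "(B + s) * (B - s) = 1"
    using s by (simp add: algebra_simps power2_eq_square)
  have no_unit: "norm (B + s) \<noteq> 1"
  proof
    assume n: "norm (B + s) = 1"
    define t where "t = B + s"
    have "t * (B - s) = 1" "t * cnj t = 1"
      using prod1 n complex_norm_square[of t] by (simp_all add: t_def)
    then have "B - s = cnj t"
      by (metis mult_cancel_left mult_zero_left zero_neq_one)
    then have "2 * B = t + cnj t"
      by (simp add: t_def algebra_simps)
    then have B: "2 * B = of_real (2 * Re t)"
      by (simp add: complex_add_cnj)
    then have "B = of_real (Re t)"
      by (simp add: complex_eq_iff)
    then have eq: "theta N j * of_real (w_fun N c z) = of_real (Re t - 1)"
      by (simp add: B_def algebra_simps)
    have "Re t \<le> 1"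
      using complex_Re_le_cmod[of t] n by (simp add: t_def)
    have "theta N j = of_real ((Re t - 1) / w_fun N c z)"
      using eq w by (simp add: field_simps)
    moreover have "norm (theta N j) = 1"
      by (simp add: theta_def)
    ultimately have "\<bar>(Re t - 1) / w_fun N c z\<bar> = 1"
      by (metis norm_of_real)
    moreover have "(Re t - 1) / w_fun N c z \<le> 0"
      using \<open>Re t \<le> 1\<close> w by (simp add: divide_nonpos_pos)
    ultimately have "(Re t - 1) / w_fun N c z = - 1"
      by linarith
    with \<open>theta N j = of_real ((Re t - 1) / w_fun N c z)\<close> have "theta N j = - 1"
      by simp
    then show False
      using theta_neq_minus_one assms by blast
  qed
  have norms: "norm (B + s) * norm (B - s) = 1"
    using prod1 by (metis norm_mult norm_one)
  have root: "is_small_root N c z j u \<longleftrightarrow> (u = B + s \<or> u = B - s) \<and> norm u < 1" for u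
    unfolding is_small_root_def B_def[symmetric] fac by auto
  show ?thesis
  proof (cases "norm (B + s) < 1")
    case True
    have "\<not> norm (B - s) < 1"
    proof
      assume "norm (B - s) < 1"
      then have "norm (B + s) * norm (B - s) < 1 * 1"
        using True by (intro mult_strict_mono') auto
      with norms show False by simp
    qed
    with True show ?thesis
      by (auto simp: root)
  next
    case False
    with no_unit have g: "norm (B + s) > 1"
      by simp
    have "norm (B - s) < 1"
    proof (rule ccontr)
      assume "\<not> norm (B - s) < 1"
      then have "1 * 1 < norm (B + s) * norm (B - s)"
        using g by (intro mult_less_le_imp_less) auto
      with norms show False by simp
    qed
    with False show ?thesis
      by (auto simp: root)
  qed
qed


section \<open>The interpolation polynomials\<close>

definition L_tilde ::
  "nat \<Rightarrow> real \<Rightarrow> real \<Rightarrow> (nat \<Rightarrow> complex poly) \<Rightarrow> nat \<Rightarrow> complex poly" where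
  "L_tilde N c z P k =
     P k * (\<Prod>j\<in>{1..2 * N} - {k}.
              smult (1 / (u_root N c z k - u_root N c z j)) [:- u_root N c z j, 1:])"

end

theory Submission
  imports Defs
begin

text \<open>
  Write \<open>\<phi>(\<zeta>)\<close> for the generating function of one step. The binomial theorem gives
  \<open>\<phi>(\<zeta>) = 1 - c (-1)\<^sup>N (1 - \<zeta>)\<^sup>2\<^sup>N / \<zeta>\<^sup>N\<close>, and the roots \<open>u\<^sub>j(z)\<close> are exactly the \<open>2N\<close>
  distinct solutions of \<open>z \<phi>(u) = 1\<close>. For such a \<open>u\<close> the process \<open>z\<^sup>n u powi S\<^sub>n\<close> is a
  martingale for the signed law of the walk, and optional stopping at the exit time shows that
  the double generating function takes the value \<open>1\<close> at \<open>\<zeta> = u\<close>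
  (\<open>exit_genfun_eq_1\<close>). The contribution of the trajectories that have not left \<open>(a, b)\<close> by time
  \<open>n\<close> vanishes in the limit because the total variation of the law of \<open>n\<close> steps is at most
  \<open>M\<^sub>1\<^sup>n\<close>, the walk stays in a finite set, and \<open>z < 1 / M\<^sub>1\<close>.

  The exit position ranges over \<open>{a - N + 1..b + N - 1}\<close>, so multiplying the double
  generating function by \<open>\<zeta> powi (N - 1 - a)\<close> gives a polynomial \<open>M\<close> in \<open>\<zeta>\<close> of degree at most
  \<open>(b - a - 1) + (2N - 1)\<close>, with \<open>M(u\<^sub>j) = u\<^sub>j powi (N - 1 - a)\<close> at each of the \<open>2N\<close> nodes. What
  remains is pure interpolation (\<open>interpolation_with_multipliers\<close>). The Lagrange interpolant
  of these values has degree below \<open>2N\<close> and differs from \<open>M\<close> by a multiple \<open>W Q\<close> of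
  \<open>W = \<Prod>\<^sub>j (\<zeta> - u\<^sub>j)\<close>. Since \<open>W\<close> is a constant times \<open>\<zeta> - u\<^sub>k\<close> times the Lagrange basis
  polynomial of the node \<open>u\<^sub>k\<close>, a multiplier \<open>P\<^sub>k = 1 + (\<zeta> - u\<^sub>k) R\<^sub>k\<close> adds a multiple of
  \<open>W R\<^sub>k\<close> to the interpolant, and it is enough to write \<open>Q\<close> as a sum of multiples of the \<open>R\<^sub>k\<close>.
  There are at least two nodes, which leaves room to give every \<open>R\<^sub>k\<close> the exact degree
  \<open>b - a - 2\<close>.
\<close>


section \<open>Interpolation with multipliers of prescribed degree\<close>

lemma prod_linear_factors_dvd:
  fixes p :: "'a::field poly"
  assumes "finite I" and "inj_on u I" and "\<And>i. i \<in> I \<Longrightarrow> poly p (u i) = 0"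
  shows "(\<Prod>i\<in>I. [:- u i, 1:]) dvd p"
  using assms
proof (induction I arbitrary: p rule: finite_induct)
  case empty
  then show ?case by simp
next
  case (insert i I)
  obtain q where q: "p = [:- u i, 1:] * q"
    using insert.prems(2)[of i] by (auto simp: poly_eq_0_iff_dvd elim: dvdE)
  have "poly q (u j) = 0" if "j \<in> I" for j
  proof -
    have "u j \<noteq> u i"
      using insert.prems(1) insert.hyps that by (auto simp: inj_on_def)
    moreover have "poly p (u j) = 0"
      using insert.prems that by simp
    ultimately show ?thesis
      by (simp add: q)
  qed
  moreover have "inj_on u I"
    using insert.prems(1) by simp
  ultimately have "(\<Prod>i\<in>I. [:- u i, 1:]) dvd q"
    using insert.IH by blast
  then show ?case
    using insert.hyps by (simp add: q mult_dvd_mono del: mult_pCons_left)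
qed

definition lagrange_basis :: "('i \<Rightarrow> 'a::field) \<Rightarrow> 'i set \<Rightarrow> 'i \<Rightarrow> 'a poly" where
  "lagrange_basis u I k = (\<Prod>j\<in>I - {k}. smult (1 / (u k - u j)) [:- u j, 1:])"

lemma poly_lagrange_basis:
  assumes "finite I" and "inj_on u I" and "j \<in> I" and "k \<in> I"
  shows "poly (lagrange_basis u I k) (u j) = (if j = k then 1 else 0)"
proof (cases "j = k")
  case True
  have "poly (lagrange_basis u I k) (u k) = (\<Prod>i\<in>I - {k}. 1 / (u k - u i) * (u k - u i))"
    unfolding lagrange_basis_def poly_prod poly_smult by simp
  also have "\<dots> = 1"
    using assms by (intro prod.neutral) (auto simp: inj_on_def)
  finally show ?thesis
    using True by simp
next
  case False
  then have "\<exists>i\<in>I - {k}. (u j - u i) / (u k - u i) = 0"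
    using assms by auto
  then show ?thesis
    using False assms by (auto simp: lagrange_basis_def poly_prod intro!: prod_zero)
qed

lemma lagrange_basis_factored:
  "lagrange_basis u I k
    = smult (\<Prod>j\<in>I - {k}. 1 / (u k - u j)) (\<Prod>j\<in>I - {k}. [:- u j, 1:])"
  unfolding lagrange_basis_def prod_smult ..

text \<open>
  This is why adding a multiple of \<open>x - u\<^sub>k\<close> to the factor of the \<open>k\<close>-th basis polynomial changes a
  sum of such terms by a multiple of the node polynomial \<open>\<Prod>\<^sub>j (x - u\<^sub>j)\<close>, whatever \<open>k\<close> is.
\<close>

lemma linear_factor_times_lagrange_basis:
  assumes "finite I" and "k \<in> I"
  shows "[:- u k, 1:] * lagrange_basis u I k
    = smult (\<Prod>j\<in>I - {k}. 1 / (u k - u j)) (\<Prod>j\<in>I. [:- u j, 1:])"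
  using assms by (simp add: lagrange_basis_factored prod.remove[of I k] del: mult_pCons_left)

lemma degree_prod_linear:
  fixes u :: "'i \<Rightarrow> 'a::field"
  shows "finite I \<Longrightarrow> degree (\<Prod>i\<in>I. [:- u i, 1:]) = card I"
  by (subst degree_prod_eq_sum_degree) auto

lemma degree_lagrange_basis_le:
  assumes "finite I" and "k \<in> I"
  shows "degree (lagrange_basis u I k) \<le> card I - 1"
proof -
  have "degree (lagrange_basis u I k) \<le> degree (\<Prod>j\<in>I - {k}. [:- u j, 1:])"
    by (simp add: lagrange_basis_factored)
  also have "\<dots> = card I - 1"
    using assms by (simp add: degree_prod_linear)
  finally show ?thesis .
qed

text \<open>
  All summands but one are the same monomial \<open>t x\<^sup>d\<close>, and the remaining one is what is left of \<open>Q\<close>.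
  Its coefficient at \<open>x\<^sup>d\<close> is an injective affine function of \<open>t\<close> once there is a second summand, so
  it vanishes for at most one \<open>t\<close>. A single summand would be \<open>Q\<close> itself, whose degree may be
  smaller than \<open>d\<close>. The summands are also required to be nonzero because the zero polynomial has
  degree \<open>0\<close>, which matters when \<open>d = 0\<close>.
\<close>

lemma split_into_polys_of_exact_degree:
  fixes Q :: "'a::field_char_0 poly"
  assumes "finite I" and "card I \<ge> 2" and "degree Q \<le> d"
  shows "\<exists>R. (\<forall>k\<in>I. degree (R k) = d \<and> R k \<noteq> 0) \<and> (\<Sum>k\<in>I. R k) = Q"
proof -
  define m :: 'a where "m = of_nat (card I - 1)"
  have "m \<noteq> 0"
    using assms(2) by (simp add: m_def)
  \<comment> \<open>Besides \<open>0\<close>, only \<open>coeff Q d / m\<close> is excluded, and it is not both \<open>1\<close> and \<open>-1\<close>.\<close>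
  obtain t :: 'a where t: "t \<noteq> 0" "coeff Q d - m * t \<noteq> 0"
  proof (cases "coeff Q d = m")
    case True
    with \<open>m \<noteq> 0\<close> show ?thesis
      by (intro that[of "-1"]) auto
  qed (auto intro: that[of 1])
  obtain i where i: "i \<in> I"
    using assms(2) by fastforce
  define R where "R k = (if k = i then Q - monom (m * t) d else monom t d)" for k
  have "coeff (R k) d \<noteq> 0" for k
    using t by (auto simp: R_def)
  moreover have "degree (R k) \<le> d" for k
    using assms(3) degree_monom_le[of _ d] by (auto simp: R_def intro!: degree_diff_le)
  ultimately have "degree (R k) = d \<and> R k \<noteq> 0" for k
    by (metis le_antisym le_degree coeff_0)
  moreover have "(\<Sum>k\<in>I. R k) = R i + (\<Sum>k\<in>I - {i}. R k)"
    using assms(1) i by (rule sum.remove)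
  moreover have "(\<Sum>k\<in>I - {i}. R k) = (\<Sum>k\<in>I - {i}. monom t d)"
    by (rule sum.cong) (auto simp: R_def)
  moreover have "\<dots> = monom (m * t) d"
    using assms(1) i by (simp add: m_def of_nat_poly smult_monom)
  ultimately have "(\<forall>k\<in>I. degree (R k) = d \<and> R k \<noteq> 0) \<and> (\<Sum>k\<in>I. R k) = Q"
    by (simp add: R_def)
  then show ?thesis
    by blast
qed

text \<open>
  Let \<open>W\<close> be the node polynomial and \<open>W Q\<close> the difference between \<open>M\<close> and its Lagrange interpolant.
  With \<open>P\<^sub>k = 1 + (x - u\<^sub>k) R\<^sub>k / \<kappa>\<^sub>k\<close>, where \<open>\<kappa>\<^sub>k\<close> absorbs the value \<open>M(u\<^sub>k)\<close> and the constant of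
  \<open>linear_factor_times_lagrange_basis\<close>, the sum becomes the interpolant plus \<open>W \<Sum>\<^sub>k R\<^sub>k\<close>. Hence any
  decomposition \<open>Q = \<Sum>\<^sub>k R\<^sub>k\<close> works, and one with summands of exact degree \<open>d\<close> gives the degree of
  the \<open>P\<^sub>k\<close>. The values \<open>M(u\<^sub>k)\<close> have to be nonzero for the division by \<open>\<kappa>\<^sub>k\<close>.
\<close>

lemma interpolation_with_multipliers:
  fixes M :: "'a::field_char_0 poly"
  assumes "finite I" and "card I \<ge> 2" and "inj_on u I"
    and nz: "\<And>k. k \<in> I \<Longrightarrow> poly M (u k) \<noteq> 0"
    and deg: "degree M \<le> Suc d + (card I - 1)"
  shows "\<exists>P. (\<forall>k\<in>I. degree (P k) = Suc d \<and> poly (P k) (u k) = 1) \<and>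
    (\<Sum>k\<in>I. smult (poly M (u k)) (P k * lagrange_basis u I k)) = M"
proof -
  define W where "W = (\<Prod>j\<in>I. [:- u j, 1:])"
  define y where "y k = poly M (u k)" for k
  define \<kappa> where "\<kappa> k = y k * (\<Prod>j\<in>I - {k}. 1 / (u k - u j))" for k
  define D where "D = M - (\<Sum>k\<in>I. smult (y k) (lagrange_basis u I k))"
  have \<kappa>: "\<kappa> k \<noteq> 0" if "k \<in> I" for k
    using assms that by (auto simp: \<kappa>_def y_def prod_zero_iff inj_on_def)
  have "poly D (u j) = 0" if "j \<in> I" for j
  proof -
    have "(\<Sum>k\<in>I. y k * poly (lagrange_basis u I k) (u j)) = (\<Sum>k\<in>I. if j = k then y k else 0)"
      using that by (intro sum.cong) (auto simp: poly_lagrange_basis assms)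
    also have "\<dots> = y j"
      using that assms(1) by simp
    finally show ?thesis
      by (simp add: D_def y_def poly_sum)
  qed
  then have "W dvd D"
    unfolding W_def using assms(1,3) by (intro prod_linear_factors_dvd)
  then obtain Q where Q: "D = W * Q"
    by (rule dvdE)
  have "W \<noteq> 0"
    using assms(1) by (auto simp: W_def prod_zero_iff)
  have "degree D \<le> Suc d + (card I - 1)"
    unfolding D_def using assms(1)
    by (intro degree_diff_le deg degree_sum_le order.trans[OF degree_smult_le]
        trans_le_add2 degree_lagrange_basis_le)
  then have "degree Q \<le> d"
  proof (cases "Q = 0")
    case False
    then have "degree D = card I + degree Q"
      using Q \<open>W \<noteq> 0\<close> degree_prod_linear[OF assms(1), of u] by (simp add: degree_mult_eq W_def)
    with \<open>degree D \<le> _\<close> assms(2) show ?thesis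
      by simp
  qed simp
  then obtain R where R: "\<And>k. k \<in> I \<Longrightarrow> degree (R k) = d \<and> R k \<noteq> 0" "(\<Sum>k\<in>I. R k) = Q"
    using split_into_polys_of_exact_degree[OF assms(1,2)] by blast
  define P where "P k = 1 + [:- u k, 1:] * smult (1 / \<kappa> k) (R k)" for k
  have "degree (P k) = Suc d" if "k \<in> I" for k
  proof -
    have "degree ([:- u k, 1:] * smult (1 / \<kappa> k) (R k)) = Suc d"
      using R(1)[OF that] \<kappa>[OF that] by (subst degree_mult_eq) auto
    then show ?thesis
      unfolding P_def by (subst degree_add_eq_right) auto
  qed
  moreover have "poly (P k) (u k) = 1" for k
    by (simp add: P_def)
  moreover have "(\<Sum>k\<in>I. smult (y k) (P k * lagrange_basis u I k)) = M"
  proof -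
    have "smult (y k) (P k * lagrange_basis u I k)
        = smult (y k) (lagrange_basis u I k) + W * R k" if "k \<in> I" for k
    proof -
      have "P k * lagrange_basis u I k = lagrange_basis u I k
          + smult (1 / \<kappa> k) (R k) * ([:- u k, 1:] * lagrange_basis u I k)"
        by (simp add: P_def algebra_simps del: mult_pCons_left mult_pCons_right)
      also have "\<dots> = lagrange_basis u I k + smult (1 / y k) (W * R k)"
        unfolding linear_factor_times_lagrange_basis[OF assms(1) that] W_def[symmetric]
        using \<kappa>[OF that] by (simp add: \<kappa>_def mult.commute)
      finally show ?thesis
        using \<kappa>[OF that] by (simp add: smult_add_right \<kappa>_def)
    qed
    then have "(\<Sum>k\<in>I. smult (y k) (P k * lagrange_basis u I k))
        = (\<Sum>k\<in>I. smult (y k) (lagrange_basis u I k)) + W * Q"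
      by (simp add: sum.distrib R(2)[symmetric] sum_distrib_left)
    then show ?thesis
      unfolding Q[symmetric] by (simp add: D_def)
  qed
  ultimately show ?thesis
    unfolding y_def by blast
qed


section \<open>The roots and the generating function of one step\<close>

text \<open>
  Up to a constant and the factor \<open>u\<^sup>-\<^sup>N\<close>, the perturbation of the unit mass at \<open>0\<close> is the binomial
  expansion of \<open>(1 - u)\<^sup>2\<^sup>N\<close>.
\<close>

lemma step_generating_function:
  fixes u :: complex
  assumes "u \<noteq> 0"
  shows "(\<Sum>k\<in>{- int N..int N}. of_real (step_prob N c k) * u powi k)
    = 1 - of_real c * (-1) ^ N * (1 - u) ^ (2 * N) / u ^ N"
proof -
  let ?q = "\<lambda>k. (-1) powi (k - 1) * c * real ((2 * N) choose nat (k + int N))"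
  have "(\<Sum>k\<in>{- int N..int N}. of_real (step_prob N c k) * u powi k)
      = (\<Sum>k\<in>{- int N..int N}. (if k = 0 then 1 else 0) + of_real (?q k) * u powi k)"
    by (intro sum.cong) (auto simp: step_prob_def algebra_simps)
  also have "\<dots> = 1 + (\<Sum>k\<in>{- int N..int N}. of_real (?q k) * u powi k)"
    by (simp add: sum.distrib)
  also have "(\<Sum>k\<in>{- int N..int N}. of_real (?q k) * u powi k)
      = (\<Sum>m\<le>2 * N. of_real (?q (int m - int N)) * u powi (int m - int N))"
    by (rule sum.reindex_bij_witness[of _ "\<lambda>m. int m - int N" "\<lambda>k. nat (k + int N)"]) auto
  also have "\<dots> = (\<Sum>m\<le>2 * N. (- (of_real c * (-1) ^ N) / u ^ N)
      * (of_nat ((2 * N) choose m) * (- u) ^ m * 1 ^ (2 * N - m)))"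
  proof (intro sum.cong refl)
    fix m
    \<comment> \<open>Shifting the exponent by an even number makes it a natural number.\<close>
    have "int m - int N - 1 = int (m + N + 1) - 2 * (int N + 1)"
      by simp
    then have "(-1 :: real) powi (int m - int N - 1) = (-1) powi (int (m + N + 1) - 2 * (int N + 1))"
      by (simp only:)
    also have "\<dots> = (-1) ^ (m + N + 1)"
      by (subst power_int_diff) (auto simp: power_int_minus_one_mult_self power_int_mult simp flip: power_int_of_nat)
    finally have s: "(-1 :: real) powi (int m - int N - 1) = (-1) ^ (m + N + 1)" .
    have v: "u powi (int m - int N) = u ^ m / u ^ N"
      using assms by (simp add: power_int_diff)
    show "of_real (?q (int m - int N)) * u powi (int m - int N) = (- (of_real c * (-1) ^ N) / u ^ N)
      * (of_nat ((2 * N) choose m) * (- u) ^ m * 1 ^ (2 * N - m))"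
      unfolding s v by (simp add: power_add power_minus[of u] )
  qed
  also have "\<dots> = (- (of_real c * (-1) ^ N) / u ^ N) * (- u + 1) ^ (2 * N)"
    unfolding binomial_ring sum_distrib_left ..
  finally show ?thesis
    by simp
qed

text \<open>At \<open>u = 1\<close> the preceding formula says that the step probabilities sum to \<open>1\<close>.\<close>

lemma M1_ge_1:
  assumes "N \<ge> 1"
  shows "M1 N c \<ge> 1"
proof -
  have "of_real (\<Sum>k\<in>{- int N..int N}. step_prob N c k) = (1 :: complex)"
    using step_generating_function[of 1 N c] assms by simp
  then have "\<bar>\<Sum>k\<in>{- int N..int N}. step_prob N c k\<bar> = 1"
    by (simp only: of_real_eq_1_iff abs_one)
  then show ?thesis
    unfolding M1_def by (metis sum_abs)
qed

lemma theta_power: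
  assumes "1 \<le> N"
  shows "theta N j ^ N = - ((-1) ^ N)"
proof -
  have "real N * ((2 * real j - 1) / real N * pi) = 2 * real j * pi - pi"
    using assms by (simp add: field_simps)
  then have "cis ((2 * real j - 1) / real N * pi) ^ N = cis (2 * real j * pi - pi)"
    unfolding Complex.DeMoivre by (rule arg_cong)
  also have "\<dots> = -1"
    using cis_multiple_2pi[of "real j"] by (simp add: cis_divide[symmetric] mult_ac)
  finally show ?thesis
    unfolding theta_def by (subst power_minus) simp
qed

lemma inj_on_theta: "inj_on (theta N) {1..N}"
proof (rule inj_onI)
  fix j k assume jk: "j \<in> {1..N}" "k \<in> {1..N}" "theta N j = theta N k"
  then have "cis ((2 * real j - 1) / real N * pi) = cis ((2 * real k - 1) / real N * pi)"
    by (simp add: theta_def)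
  then have "sin ((2 * real j - 1) / real N * pi) = sin ((2 * real k - 1) / real N * pi) \<and>
      cos ((2 * real j - 1) / real N * pi) = cos ((2 * real k - 1) / real N * pi)"
    by (metis cis.sel)
  then obtain n :: int
    where "(2 * real j - 1) / real N * pi = (2 * real k - 1) / real N * pi + 2 * pi * of_int n"
    unfolding sin_cos_eq_iff by blast
  then have "pi * (2 * real j - 1) = pi * (2 * real k - 1 + 2 * of_int n * real N)"
    using jk by (simp add: field_simps)
  then have "real j = real k + of_int n * real N"
    by simp
  then have "of_int (int j) = (of_int (int k + n * int N) :: real)"
    by simp
  then have eq: "int j = int k + n * int N"
    by (simp only: of_int_eq_iff)
  have "\<bar>n * int N\<bar> < int N"
    using eq jk by auto
  then have "\<bar>n\<bar> * int N < 1 * int N"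
    by (simp add: abs_mult)
  then have "n = 0"
    by (simp only: mult_less_cancel_right) auto
  with eq show "j = k"
    by simp
qed

text \<open>
  The quadratic equation of \<open>u\<^sub>j\<close> is invariant under \<open>u \<mapsto> 1 / u\<close> and says
  \<open>(1 - u)\<^sup>2 / u = 2 \<theta>\<^sub>j w(z)\<close>. So a root determines \<open>\<theta>\<^sub>j\<close>, and the modulus tells the small roots
  from their inverses; this makes all \<open>2N\<close> roots distinct.
\<close>

context
  fixes N :: nat and c z :: real
  assumes N: "1 \<le> N" and c: "0 < c" and z: "0 < z" "z < 1"
begin

lemma small_root:
  assumes "1 \<le> j" "j \<le> N"
  shows "is_small_root N c z j (u_root N c z j)"
  using theI'[OF ex1_small_root[OF assms c z]] assms by (simp add: u_root_def)

lemma u_root_upper: "1 \<le> j \<Longrightarrow> u_root N c z (j + N) = 1 / u_root N c z j" if "j \<le> N"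
  using that by (simp add: u_root_def)

lemma small_root_nonzero: "is_small_root N c z j u \<Longrightarrow> u \<noteq> 0"
  by (auto simp: is_small_root_def)

lemma small_root_quadratic:
  assumes "is_small_root N c z j u"
  shows "(1 - u)\<^sup>2 = 2 * theta N j * of_real (w_fun N c z) * u"
  using assms unfolding is_small_root_def by algebra

lemma small_roots_distinct:
  assumes "is_small_root N c z j u" "is_small_root N c z k u" "j \<in> {1..N}" "k \<in> {1..N}"
  shows "j = k"
proof -
  have "w_fun N c z \<noteq> 0"
    using N c z by (simp add: w_fun_def)
  then have "theta N j = theta N k"
    using small_root_quadratic[OF assms(1)] small_root_quadratic[OF assms(2)]
      small_root_nonzero[OF assms(1)] by simp
  then show ?thesis
    by (rule inj_onD[OF inj_on_theta]) (rule assms)+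
qed

lemma u_root_cases:
  assumes "j \<in> {1..2 * N}"
  obtains "j \<le> N" "is_small_root N c z j (u_root N c z j)"
  | "j > N" "is_small_root N c z (j - N) (1 / u_root N c z j)"
proof (cases "j \<le> N")
  case True
  then show ?thesis
    using that(1) assms small_root by simp
next
  case False
  then have "u_root N c z j = 1 / u_root N c z (j - N)"
    using assms u_root_upper[of "j - N"] by simp
  then show ?thesis
    using that(2) False assms small_root[of "j - N"] by simp
qed

lemma u_root_nonzero: "j \<in> {1..2 * N} \<Longrightarrow> u_root N c z j \<noteq> 0"
  by (erule u_root_cases) (auto dest: small_root_nonzero)

lemma inj_on_u_root: "inj_on (u_root N c z) {1..2 * N}"
proof (rule inj_onI)
  fix j k assume j: "j \<in> {1..2 * N}" and k: "k \<in> {1..2 * N}"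
    and eq: "u_root N c z j = u_root N c z k"
  have small: "norm u < 1" if "is_small_root N c z i u" for i u
    using that by (simp add: is_small_root_def)
  have no: False if "is_small_root N c z i u" "is_small_root N c z i' (1 / u)" for i i' u
    using small[OF that(1)] small[OF that(2)] small_root_nonzero[OF that(1)]
    by (simp add: norm_divide)
  from j show "j = k"
  proof (cases rule: u_root_cases)
    case j: 1
    from k show ?thesis
    proof (cases rule: u_root_cases)
      case 1
      then show ?thesis using j eq small_roots_distinct[of j _ k] \<open>j \<in> _\<close> k by auto
    next
      case 2
      then show ?thesis using j(2) eq no by metis
    qed
  next
    case j: 2
    from k show ?thesis
    proof (cases rule: u_root_cases)
      case 1
      then show ?thesis using j(2) eq no by metis
    next
      case k': 2
      have "j - N = k - N"
        using j(2) k'(2) eq j(1) k'(1) \<open>j \<in> _\<close> k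
        by (intro small_roots_distinct[of "j - N" "1 / u_root N c z j"]) auto
      then show ?thesis using j(1) k'(1) by simp
    qed
  qed
qed

text \<open>
  The \<open>N\<close>-th power of \<open>(1 - u)\<^sup>2 / u = 2 \<theta>\<^sub>j w(z)\<close> does not depend on \<open>j\<close>: it equals
  \<open>- (-1)\<^sup>N (1 - z) / (c z)\<close>, which is the value that \<open>step_generating_function\<close> requires.
\<close>

lemma step_generating_function_at_u_root:
  assumes "j \<in> {1..2 * N}"
  shows "of_real z * (\<Sum>k\<in>{- int N..int N}. of_real (step_prob N c k) * u_root N c z j powi k) = 1"
proof -
  define u where "u = u_root N c z j"
  have u: "u \<noteq> 0"
    using u_root_nonzero[OF assms] by (simp add: u_def)
  have "\<exists>i. (1 - u)\<^sup>2 = 2 * theta N i * of_real (w_fun N c z) * u"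
    using assms
  proof (cases rule: u_root_cases)
    case 1
    then show ?thesis
      using small_root_quadratic u_def by blast
  next
    case 2
    have "(1 - u)\<^sup>2 = (1 - 1 / u)\<^sup>2 * u\<^sup>2"
      using u by (simp add: field_simps power2_eq_square)
    also have "\<dots> = 2 * theta N (j - N) * of_real (w_fun N c z) * (1 / u) * u\<^sup>2"
      unfolding u_def small_root_quadratic[OF 2(2)] ..
    also have "\<dots> = 2 * theta N (j - N) * of_real (w_fun N c z) * u"
      using u by (simp add: power2_eq_square)
    finally show ?thesis ..
  qed
  then obtain i where i: "(1 - u)\<^sup>2 = 2 * theta N i * of_real (w_fun N c z) * u" ..
  have "(2 * w_fun N c z) ^ N = (1 - z) / (c * z)"
    using N c z by (simp add: w_fun_def)
  then have w: "(2 * of_real (w_fun N c z)) ^ N = (of_real ((1 - z) / (c * z)) :: complex)"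
    by (metis of_real_mult of_real_numeral of_real_power)
  have "(1 - u) ^ (2 * N) = (2 * of_real (w_fun N c z)) ^ N * theta N i ^ N * u ^ N"
    unfolding power_mult i by (simp add: power_mult_distrib mult_ac)
  also have "\<dots> = of_real ((1 - z) / (c * z)) * (- ((-1) ^ N)) * u ^ N"
    unfolding w theta_power[OF N] ..
  finally have "(1 - u) ^ (2 * N) / u ^ N = of_real ((1 - z) / (c * z)) * (- ((-1) ^ N))"
    using u by simp
  then have "of_real c * (-1) ^ N * (1 - u) ^ (2 * N) / u ^ N
      = of_real c * (-1) ^ N * (of_real ((1 - z) / (c * z)) * (- ((-1) ^ N)))"
    by (metis times_divide_eq_right)
  also have "\<dots> = - of_real ((1 - z) / z)"
    using c by (simp flip: power_mult_distrib)
  finally show ?thesis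
    unfolding u_def[symmetric] step_generating_function[OF u]
    using z by (simp add: field_simps)
qed

end


section \<open>Optional stopping\<close>

text \<open>
  Integration against the signed law of the first \<open>n\<close> steps. Working with integrals of functions
  rather than with probabilities of events lets the martingale argument avoid a summation over the
  position of the walk.
\<close>

definition walk_expect :: "nat \<Rightarrow> real \<Rightarrow> nat \<Rightarrow> ((nat \<Rightarrow> int) \<Rightarrow> complex) \<Rightarrow> complex" where
  "walk_expect N c n f =
     (\<Sum>x\<in>{1..n} \<rightarrow>\<^sub>E {- int N..int N}. of_real (\<Prod>i=1..n. step_prob N c (x i)) * f x)"

lemma finite_trajectories: "finite ({1..n::nat} \<rightarrow>\<^sub>E {- int N..int N})"
  by (intro finite_PiE) auto

lemma walk_prob_eq_walk_expect:
  "of_real (walk_prob N c n A) = walk_expect N c n (\<lambda>x. if A x then 1 else 0)"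
  unfolding walk_prob_def walk_expect_def of_real_sum
  by (rule sum.mono_neutral_cong_left[OF finite_trajectories]) auto

lemma walk_expect_0: "walk_expect N c 0 f = f (\<lambda>_. undefined)"
  by (simp add: walk_expect_def)

lemma walk_expect_cong:
  assumes "\<And>x. x \<in> {1..n} \<rightarrow>\<^sub>E {- int N..int N} \<Longrightarrow> f x = g x"
  shows "walk_expect N c n f = walk_expect N c n g"
  unfolding walk_expect_def by (intro sum.cong) (auto simp: assms)

lemma walk_expect_mult: "walk_expect N c n (\<lambda>x. f x * y) = walk_expect N c n f * y"
  unfolding walk_expect_def sum_distrib_right mult.assoc ..

lemma walk_expect_add:
  "walk_expect N c n (\<lambda>x. f x + g x) = walk_expect N c n f + walk_expect N c n g"
  by (simp add: walk_expect_def sum.distrib distrib_left)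

lemma walk_expect_sum:
  "walk_expect N c n (\<lambda>x. \<Sum>i\<in>I. f i x) = (\<Sum>i\<in>I. walk_expect N c n (f i))"
  unfolding walk_expect_def sum_distrib_left by (rule sum.swap)

lemma walk_expect_Suc:
  "walk_expect N c (Suc n) f
    = (\<Sum>k\<in>{- int N..int N}. of_real (step_prob N c k) * walk_expect N c n (\<lambda>x. f (x(Suc n := k))))"
proof -
  let ?K = "{- int N..int N}"
  have set: "{1..Suc n} = insert (Suc n) {1..n}"
    by auto
  have pr: "(\<Prod>i=1..Suc n. step_prob N c ((x(Suc n := k)) i))
      = step_prob N c k * (\<Prod>i=1..n. step_prob N c (x i))" for x k
  proof -
    have "(\<Prod>i=1..n. step_prob N c ((x(Suc n := k)) i)) = (\<Prod>i=1..n. step_prob N c (x i))"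
      by (intro prod.cong) auto
    then show ?thesis
      by (simp add: set)
  qed
  have inj: "inj_on (\<lambda>(y, g). g(Suc n := y)) (?K \<times> ({1..n} \<rightarrow>\<^sub>E ?K))"
    using inj_combinator[of "Suc n" "{1..n}" "\<lambda>_. ?K"] by simp
  have "walk_expect N c (Suc n) f = (\<Sum>(k, x)\<in>?K \<times> ({1..n} \<rightarrow>\<^sub>E ?K).
      of_real (\<Prod>i=1..Suc n. step_prob N c ((x(Suc n := k)) i)) * f (x(Suc n := k)))"
    unfolding walk_expect_def set PiE_insert_eq
    by (subst sum.reindex[OF inj]) (simp add: case_prod_unfold)
  also have "\<dots> = (\<Sum>k\<in>?K. of_real (step_prob N c k) * walk_expect N c n (\<lambda>x. f (x(Suc n := k))))"
    unfolding pr by (simp add: walk_expect_def sum.cartesian_product[symmetric] sum_distrib_left mult_ac)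
  finally show ?thesis .
qed

lemma norm_walk_expect_le:
  assumes "\<And>x. norm (f x) \<le> B"
  shows "norm (walk_expect N c n f) \<le> M1 N c ^ n * B"
proof -
  let ?X = "{1..n} \<rightarrow>\<^sub>E {- int N..int N}"
  have "norm (walk_expect N c n f) \<le> (\<Sum>x\<in>?X. (\<Prod>i=1..n. \<bar>step_prob N c (x i)\<bar>) * B)"
    unfolding walk_expect_def
    by (intro sum_norm_le) (auto simp: norm_mult abs_prod intro!: mult_left_mono assms prod_nonneg
        simp del: of_real_prod)
  also have "\<dots> = (\<Prod>i=1..n. \<Sum>k\<in>{- int N..int N}. \<bar>step_prob N c k\<bar>) * B"
    by (subst prod_sum_PiE) (auto simp: sum_distrib_right)
  finally show ?thesis
    by (simp add: M1_def)
qed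

lemma walk_0 [simp]: "walk x 0 = 0"
  by (simp add: walk_def)

lemma walk_Suc: "walk x (Suc n) = walk x n + x (Suc n)"
  by (simp add: walk_def)

lemma walk_upd: "i \<le> n \<Longrightarrow> walk (x(Suc n := k)) i = walk x i"
  by (simp add: walk_def)

definition stays_inside :: "int \<Rightarrow> int \<Rightarrow> nat \<Rightarrow> (nat \<Rightarrow> int) \<Rightarrow> bool" where
  "stays_inside a b n x \<longleftrightarrow> (\<forall>i\<in>{1..n}. walk x i \<in> {a<..<b})"

lemma stays_inside_upd: "stays_inside a b n (x(Suc n := k)) \<longleftrightarrow> stays_inside a b n x"
  by (auto simp: stays_inside_def walk_upd)

text \<open>
  A step has length at most \<open>N\<close> and the last position before the exit lies in \<open>(a, b)\<close> -- also when
  the exit happens at the first step, since \<open>a < 0 < b\<close>. So the exit position lies in the exit set,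
  and summing over this set integrates over the whole event of exit at time \<open>Suc n\<close>.
\<close>

lemma exit_law_generating_function:
  fixes u :: complex
  assumes "a < 0" "0 < b"
  shows "(\<Sum>l\<in>exit_set N a b. of_real (exit_prob N c a b (Suc n) l) * u powi l)
    = walk_expect N c (Suc n)
        (\<lambda>x. if stays_inside a b n x \<and> walk x (Suc n) \<notin> {a<..<b} then u powi walk x (Suc n) else 0)"
proof -
  have eq: "of_real (exit_prob N c a b (Suc n) l) * u powi l
      = walk_expect N c (Suc n)
          (\<lambda>x. if stays_inside a b n x \<and> walk x (Suc n) = l then u powi l else 0)"
    if "l \<in> exit_set N a b" for l
  proof -
    have "of_real (exit_prob N c a b (Suc n) l)
        = walk_expect N c (Suc n) (\<lambda>x. if stays_inside a b n x \<and> walk x (Suc n) = l then 1 else 0)"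
      using that
      by (subst exit_prob_eq)
         (auto simp: exit_set_def walk_prob_eq_walk_expect stays_inside_def atLeastLessThanSuc_atLeastAtMost)
    then show ?thesis
      by (simp only: walk_expect_mult[symmetric]) (intro walk_expect_cong, simp)
  qed
  have in_exit: "walk x (Suc n) \<in> exit_set N a b"
    if x: "x \<in> {1..Suc n} \<rightarrow>\<^sub>E {- int N..int N}"
      and ins: "stays_inside a b n x" "walk x (Suc n) \<notin> {a<..<b}" for x
  proof -
    have "a < walk x n \<and> walk x n < b"
      using ins(1) assms by (cases n) (auto simp: stays_inside_def)
    moreover have "- int N \<le> x (Suc n) \<and> x (Suc n) \<le> int N"
      using x by (auto simp: PiE_iff)
    ultimately show ?thesis
      using ins(2) by (auto simp: exit_set_def walk_Suc)
  qed
  have "finite (exit_set N a b)"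
    by (simp add: exit_set_def)
  have notin: "l \<notin> {a<..<b}" if "l \<in> exit_set N a b" for l
    using that by (auto simp: exit_set_def)
  have "(\<Sum>l\<in>exit_set N a b. of_real (exit_prob N c a b (Suc n) l) * u powi l)
      = walk_expect N c (Suc n) (\<lambda>x. \<Sum>l\<in>exit_set N a b.
          if stays_inside a b n x \<and> walk x (Suc n) = l then u powi l else 0)"
    unfolding walk_expect_sum by (intro sum.cong refl eq)
  also have "\<dots> = walk_expect N c (Suc n)
        (\<lambda>x. if stays_inside a b n x \<and> walk x (Suc n) \<notin> {a<..<b} then u powi walk x (Suc n) else 0)"
  proof (rule walk_expect_cong)
    fix x assume x: "x \<in> {1..Suc n} \<rightarrow>\<^sub>E {- int N..int N}"
    have "(\<Sum>l\<in>exit_set N a b. if stays_inside a b n x \<and> walk x (Suc n) = l then u powi l else 0)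
        = (if stays_inside a b n x \<and> walk x (Suc n) \<in> exit_set N a b then u powi walk x (Suc n) else 0)"
      using \<open>finite _\<close> by (cases "stays_inside a b n x") auto
    moreover have "stays_inside a b n x \<and> walk x (Suc n) \<in> exit_set N a b
        \<longleftrightarrow> stays_inside a b n x \<and> walk x (Suc n) \<notin> {a<..<b}"
      using in_exit[OF x] notin by blast
    ultimately show "(\<Sum>l\<in>exit_set N a b. if stays_inside a b n x \<and> walk x (Suc n) = l then u powi l else 0)
        = (if stays_inside a b n x \<and> walk x (Suc n) \<notin> {a<..<b} then u powi walk x (Suc n) else 0)"
      by (simp only:)
  qed
  finally show ?thesis .
qed

text \<open>
  Optional stopping in telescoped form. Let \<open>G n\<close> be the integral of \<open>u powi S\<^sub>n\<close> over the trajectories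
  that stay in \<open>(a, b)\<close> up to time \<open>n\<close>, and \<open>e n\<close> the one over those that leave at time \<open>n + 1\<close>. One
  step multiplies \<open>G n\<close> by the generating function of the step and splits the result into
  \<open>G (n + 1) + e n\<close>. Since \<open>z\<close> compensates this factor, the \<open>z\<^sup>n\<^sup>+\<^sup>1 e n\<close> telescope to \<open>G 0 = 1\<close>.
\<close>

lemma exit_genfun_eq_1:
  fixes u :: complex
  assumes "a < 0" and "0 < b" and "u \<noteq> 0" and "norm z < 1 / M1 N c"
    and one: "z * (\<Sum>k\<in>{- int N..int N}. of_real (step_prob N c k) * u powi k) = 1"
  shows "exit_genfun N c a b z u = 1"
proof -
  define G where "G n = walk_expect N c n (\<lambda>x. if stays_inside a b n x then u powi walk x n else 0)" for n
  define e where "e n = (\<Sum>l\<in>exit_set N a b. of_real (exit_prob N c a b (Suc n) l) * u powi l)" for n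
  have M1_pos: "M1 N c > 0"
    using assms(4) by (metis less_le_trans linorder_not_less norm_ge_zero zero_less_divide_1_iff)
  have rec: "G n * (\<Sum>k\<in>{- int N..int N}. of_real (step_prob N c k) * u powi k) = G (Suc n) + e n" for n
  proof -
    have "G (Suc n) + e n
        = walk_expect N c (Suc n) (\<lambda>x. if stays_inside a b n x then u powi walk x (Suc n) else 0)"
      unfolding G_def e_def exit_law_generating_function[OF assms(1,2)] walk_expect_add[symmetric]
      by (intro walk_expect_cong) (auto simp: stays_inside_def atLeastAtMostSuc_conv)
    also have "\<dots> = (\<Sum>k\<in>{- int N..int N}. of_real (step_prob N c k) *
        walk_expect N c n (\<lambda>x. (if stays_inside a b n x then u powi walk x n else 0) * u powi k))"
      unfolding walk_expect_Suc stays_inside_upd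
      by (intro sum.cong refl arg_cong2[where f = "(*)"] walk_expect_cong)
         (auto simp: walk_Suc walk_upd power_int_add assms(3))
    also have "\<dots> = (\<Sum>k\<in>{- int N..int N}. G n * (of_real (step_prob N c k) * u powi k))"
      unfolding walk_expect_mult G_def by (simp only: mult_ac)
    finally show ?thesis
      by (simp only: sum_distrib_left)
  qed
  have tele: "z ^ Suc n * e n = z ^ n * G n - z ^ Suc n * G (Suc n)" for n
  proof -
    have "z ^ Suc n * (G (Suc n) + e n) = z ^ n * G n"
      unfolding rec[symmetric] using one by (simp add: mult_ac)
    then show ?thesis
      by (simp add: algebra_simps)
  qed
  define B where "B = (\<Sum>m\<in>{a<..<b}. norm (u powi m))"
  \<comment> \<open>The restriction to \<open>n > 0\<close> is there because \<open>stays_inside a b 0\<close> is an empty condition.\<close>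
  have bound: "norm (z ^ n * G n) \<le> (norm z * M1 N c) ^ n * B" if "n > 0" for n
  proof -
    have "norm (if stays_inside a b n x then u powi walk x n else 0) \<le> B" for x
      using that member_le_sum[of "walk x n" "{a<..<b}" "\<lambda>m. norm (u powi m)"]
      by (auto simp: B_def stays_inside_def intro!: sum_nonneg)
    then show ?thesis
      unfolding G_def norm_mult norm_power power_mult_distrib mult.assoc
      by (intro mult_left_mono norm_walk_expect_le) auto
  qed
  have "(\<lambda>n. (norm z * M1 N c) ^ n) \<longlonglongrightarrow> 0"
    using assms(4) M1_pos by (intro LIMSEQ_realpow_zero) (auto simp: field_simps)
  from tendsto_mult_left_zero[OF this] have B0: "(\<lambda>n. (norm z * M1 N c) ^ n * B) \<longlonglongrightarrow> 0" .
  have lim: "(\<lambda>n. z ^ n * G n) \<longlonglongrightarrow> 0"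
    by (rule Lim_null_comparison[OF _ B0])
       (use bound in \<open>auto simp: eventually_sequentially intro!: exI[of _ 1]\<close>)
  have "G 0 = 1"
    by (simp add: G_def walk_expect_0 stays_inside_def)
  then have "(\<lambda>n. z ^ Suc n * e n) sums 1"
    unfolding tele using telescope_sums'[OF lim] by simp
  moreover have "(\<lambda>n. z ^ Suc n * e n) sums exit_genfun N c a b z u"
  proof -
    have "(\<lambda>k. \<Sum>l\<in>exit_set N a b. (of_real (exit_prob N c a b (Suc k) l) * z ^ Suc k) * u powi l)
        sums exit_genfun N c a b z u"
      unfolding exit_genfun_def
      by (intro sums_sum sums_mult2 summable_sums summable_norm_cancel[OF exit_genfun_summable] assms)
    then show ?thesis
      by (simp add: e_def sum_distrib_left mult_ac)
  qed
  ultimately show ?thesis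
    using sums_unique2 by blast
qed


section \<open>The double generating function\<close>

lemma exit_genfun_polynomial:
  fixes a b :: int
  assumes "1 \<le> N" and "a < b"
  shows "\<exists>M. degree M \<le> nat (b - a - 1) + (2 * N - 1) \<and>
    (\<forall>\<zeta>. \<zeta> \<noteq> 0 \<longrightarrow> poly M \<zeta> = exit_genfun N c a b z \<zeta> * \<zeta> powi (int N - 1 - a))"
proof -
  define H where "H l = (\<Sum>k. of_real (exit_prob N c a b (Suc k) l) * z ^ Suc k)" for l
  define M where "M = (\<Sum>l\<in>exit_set N a b. monom (H l) (nat (l + (int N - 1 - a))))"
  have "degree M \<le> nat (b - a - 1) + (2 * N - 1)"
    unfolding M_def
  proof (intro degree_sum_le)
    fix l assume "l \<in> exit_set N a b"
    then have "nat (l + (int N - 1 - a)) \<le> nat (b - a - 1) + (2 * N - 1)"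
      using assms by (auto simp: exit_set_def)
    then show "degree (monom (H l) (nat (l + (int N - 1 - a)))) \<le> nat (b - a - 1) + (2 * N - 1)"
      using degree_monom_le order.trans by blast
  qed (simp add: exit_set_def)
  moreover have "poly M \<zeta> = exit_genfun N c a b z \<zeta> * \<zeta> powi (int N - 1 - a)" if "\<zeta> \<noteq> 0" for \<zeta>
  proof -
    have "\<zeta> ^ nat (l + (int N - 1 - a)) = \<zeta> powi l * \<zeta> powi (int N - 1 - a)"
      if "l \<in> exit_set N a b" for l
      using that assms \<open>\<zeta> \<noteq> 0\<close>
      by (subst power_int_add[symmetric]) (auto simp: exit_set_def power_int_def)
    then show ?thesis
      unfolding M_def exit_genfun_def H_def[symmetric]
      by (simp add: poly_sum poly_monom sum_distrib_right mult.assoc)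
  qed
  ultimately show ?thesis
    by blast
qed

theorem theorem8p2:
  fixes N :: nat and c z :: real and a b :: int
  assumes "1 \<le> N" and "0 < c" and "a < 0" and "0 < b"
    and "0 < z" and "z < 1 / M1 N c"
  shows "\<exists>P :: nat \<Rightarrow> complex poly.
    (\<forall>k\<in>{1..2 * N}. int (degree (P k)) = b - a - 1) \<and>
    (\<forall>j\<in>{1..2 * N}. \<forall>k\<in>{1..2 * N}.
       poly (L_tilde N c z P k) (u_root N c z j) = (if j = k then 1 else 0)) \<and>
    (\<forall>\<zeta>. \<zeta> \<noteq> 0 \<longrightarrow>
       exit_genfun N c a b (of_real z) \<zeta> =
         (\<Sum>k\<in>{1..2 * N}. poly (L_tilde N c z P k) \<zeta> *
            (v_root N c z k * \<zeta>) powi (a - int N + 1)))"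
proof -
  let ?I = "{1..2 * N}"
  let ?u = "u_root N c z"
  let ?n = "int N - 1 - a"
  have "1 / M1 N c \<le> 1"
    using M1_ge_1[OF assms(1), of c] by simp
  then have "z < 1"
    using assms(6) by linarith
  note root = \<open>1 \<le> N\<close> \<open>0 < c\<close> \<open>0 < z\<close> \<open>z < 1\<close>
  have L: "L_tilde N c z P k = P k * lagrange_basis ?u ?I k" for P k
    by (simp add: L_tilde_def lagrange_basis_def)
  obtain M where degM: "degree M \<le> nat (b - a - 1) + (2 * N - 1)"
    and M: "\<And>\<zeta>. \<zeta> \<noteq> 0 \<Longrightarrow> poly M \<zeta> = exit_genfun N c a b (of_real z) \<zeta> * \<zeta> powi ?n"
    using exit_genfun_polynomial[of N a b c "of_real z"] assms by auto
  have Mu: "poly M (?u k) = ?u k powi ?n" if "k \<in> ?I" for k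
  proof -
    have "exit_genfun N c a b (of_real z) (?u k) = 1"
      using assms that root
      by (intro exit_genfun_eq_1 step_generating_function_at_u_root u_root_nonzero) auto
    then show ?thesis
      using M u_root_nonzero[OF root that] by simp
  qed
  define d where "d = nat (b - a - 2)"
  have d: "int (Suc d) = b - a - 1" "nat (b - a - 1) = Suc d"
    using assms by (auto simp: d_def)
  obtain P where P: "\<And>k. k \<in> ?I \<Longrightarrow> degree (P k) = Suc d \<and> poly (P k) (?u k) = 1"
    and sum: "(\<Sum>k\<in>?I. smult (poly M (?u k)) (P k * lagrange_basis ?u ?I k)) = M"
  proof -
    have "poly M (?u k) \<noteq> 0" if "k \<in> ?I" for k
      using Mu[OF that] u_root_nonzero[OF root that] by simp
    moreover have "card ?I \<ge> 2" "degree M \<le> Suc d + (card ?I - 1)"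
      using assms(1) degM d by auto
    ultimately show thesis
      using interpolation_with_multipliers[of ?I ?u M d] inj_on_u_root[OF root] that by blast
  qed
  show ?thesis
  proof (intro exI[of _ P] conjI ballI allI impI)
    show "int (degree (P k)) = b - a - 1" if "k \<in> ?I" for k
      using P[OF that] d by simp
    show "poly (L_tilde N c z P k) (?u j) = (if j = k then 1 else 0)" if "j \<in> ?I" "k \<in> ?I" for j k
      using that P poly_lagrange_basis[OF _ inj_on_u_root[OF root]] by (simp add: L)
    fix \<zeta> :: complex
    assume "\<zeta> \<noteq> 0"
    have exponent: "a - int N + 1 = - ?n"
      by simp
    have split: "(1 / u * \<zeta>) powi (- n) = u powi n * \<zeta> powi (- n)" for u :: complex and n
      by (simp add: power_int_mult_distrib power_int_divide_distrib power_int_minus_divide)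
    have "exit_genfun N c a b (of_real z) \<zeta> = poly M \<zeta> * \<zeta> powi (- ?n)"
      unfolding M[OF \<open>\<zeta> \<noteq> 0\<close>] power_int_minus using \<open>\<zeta> \<noteq> 0\<close> by simp
    also have "poly M \<zeta> = (\<Sum>k\<in>?I. ?u k powi ?n * poly (L_tilde N c z P k) \<zeta>)"
      by (subst sum[symmetric]) (simp add: poly_sum Mu L)
    also have "\<dots> * \<zeta> powi (- ?n) = (\<Sum>k\<in>?I. poly (L_tilde N c z P k) \<zeta> *
            (v_root N c z k * \<zeta>) powi (a - int N + 1))"
      unfolding exponent sum_distrib_right
      by (intro sum.cong refl) (simp only: v_root_def split, simp only: mult_ac)
    finally show "exit_genfun N c a b (of_real z) \<zeta> = (\<Sum>k\<in>?I. poly (L_tilde N c z P k) \<zeta> *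
            (v_root N c z k * \<zeta>) powi (a - int N + 1))" .
  qed
qed

end
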